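(* Let $\mathcal V^1_{WP}$ and $\mathcal V^2_{\dot W\dot P}$ be linkages (linear subspaces of vectors on $W\uplus P$ and on $\dot W\uplus\dot P$). 1. If $\mathcal V_{P\dot PM_uM_y}=(\mathcal V^1_{WP}\oplus\mathcal V^2_{\dot W\dot P})\leftrightarrow\mathcal V_{W\dot WM_uM_y}$, then $\tilde{\mathcal V}_{P'\dot P'M_u'M_y'}=(\tilde{\mathcal V}^1_{W'P'}\oplus\tilde{\mathcal V}^2_{\dot W'\dot P'})\leftrightarrow\tilde{\mathcal V}_{W'\dot W'M_u'M_y'}$. 2. If $\mathcal V_{P\dot P}=(\mathcal V^1_{WP}\oplus\mathcal V^2_{\dot W\dot P})\leftrightarrow\mathcal V_{W\dot W}$, then $\tilde{\mathcal V}_{P'\dot P'}=(\tilde{\mathcal V}^1_{W'P'}\oplus\tilde{\mathcal V}^2_{\dot W'\dot P'})\leftrightarrow\tilde{\mathcal V}_{W'\dot W'}$.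
   Context: Fix a field $\mathbb F$; all index sets are finite. A vector on $X$ is a function $X\to\mathbb F$. $W,\dot W$ are disjoint copies of each other (in bijection), $P,\dot P$ are disjoint copies of each other, and $W,\dot W,P,\dot P,M_u,M_y$ are pairwise disjoint. $\mathcal V_{W\dot WM_uM_y}$, $\mathcal V_{P\dot PM_uM_y}$, $\mathcal V_{W\dot W}$, $\mathcal V_{P\dot P}$ are linear subspaces of vectors on the indicated disjoint unions. Matched composition: for spaces on sets $X,Y$, $\mathcal V_X\leftrightarrow\mathcal V_Y$ is the space on $(X\setminus Y)\uplus(Y\setminus X)$ of all $(g_{X\setminus Y},h_{Y\setminus X})$ with $g\in\mathcal V_X$, $h\in\mathcal V_Y$ and $g,h$ equal on $X\cap Y$. $\mathcal V_X\oplus\mathcal V_Y$ is the direct sum on $X\uplus Y$. $\mathcal V^\perp$ is the orthogonal complement with respect to the dot product. Primed sets $W',\dot W'$ are disjoint copies of $W$; $P',\dot P'$ disjoint copies of $P$; $M_u',M_y'$ are disjoint copies of $M_y,M_u$ respectively. A signed relabelling subscript lists, for each index block in order, its new name, with a minus sign meaning that component is negated. The adjoints are: $\tilde{\mathcal V}^1_{W'P'}:=((\mathcal V^2_{\dot W\dot P})^\perp)_{-W'P'}$ ($\dot W\mapsto-W'$, $\dot P\mapsto P'$); $\tilde{\mathcal V}^2_{\dot W'\dot P'}:=((\mathcal V^1_{WP})^\perp)_{-\dot W'\dot P'}$ ($W\mapsto-\dot W'$, $P\mapsto\dot P'$); $\tilde{\mathcal V}_{W'\dot W'M_u'M_y'}:=(\mathcal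 V_{W\dot WM_uM_y}^\perp)_{-\dot W'\,W'\,-M_y'\,M_u'}$ ($W\mapsto-\dot W'$, $\dot W\mapsto W'$, $M_u\mapsto-M_y'$, $M_y\mapsto M_u'$); $\tilde{\mathcal V}_{P'\dot P'M_u'M_y'}:=(\mathcal V_{P\dot PM_uM_y}^\perp)_{-\dot P'\,P'\,-M_y'\,M_u'}$; $\tilde{\mathcal V}_{W'\dot W'}:=(\mathcal V_{W\dot W}^\perp)_{-\dot W'W'}$; $\tilde{\mathcal V}_{P'\dot P'}:=(\mathcal V_{P\dot P}^\perp)_{-\dot P'P'}$. *)

theory Defs
  imports Complex_Main "HOL-Library.Function_Algebras"
begin

text \<open>
  All index sets are finite sets of labels from one type.  A vector on an index set \<open>X\<close> is
  represented by the function on all labels that extends it by 0 outside \<open>X\<close>; so vectors on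
  different index sets live in one vector space, and addition is pointwise.
\<close>

definition vecs :: "'i set \<Rightarrow> ('i \<Rightarrow> 'f::field) set" where
  "vecs X = {f. \<forall>i. i \<notin> X \<longrightarrow> f i = 0}"

definition restr :: "'i set \<Rightarrow> ('i \<Rightarrow> 'f::field) \<Rightarrow> 'i \<Rightarrow> 'f" where
  "restr X f = (\<lambda>i. if i \<in> X then f i else 0)"

definition scale_vec :: "'f::field \<Rightarrow> ('i \<Rightarrow> 'f) \<Rightarrow> 'i \<Rightarrow> 'f" where
  "scale_vec c f = (\<lambda>i. c * f i)"

global_interpretation vec: vector_space "scale_vec :: 'f::field \<Rightarrow> ('i \<Rightarrow> 'f) \<Rightarrow> 'i \<Rightarrow> 'f"
  by unfold_locales (auto simp: scale_vec_def fun_eq_iff algebra_simps)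

definition space_on :: "'i set \<Rightarrow> ('i \<Rightarrow> 'f::field) set \<Rightarrow> bool" where
  "space_on X V \<longleftrightarrow> V \<subseteq> vecs X \<and> vec.subspace V"

text \<open>Only meaningful for spaces on disjoint index sets; the result is then a space on their union.\<close>

definition direct_sum :: "('i \<Rightarrow> 'f::field) set \<Rightarrow> ('i \<Rightarrow> 'f) set \<Rightarrow> ('i \<Rightarrow> 'f) set"
    (infixl \<open>\<oplus>\<close> 65) where
  "V \<oplus> U = {g + h | g h. g \<in> V \<and> h \<in> U}"

text \<open>\<open>matched X Y V U\<close> is \<open>V \<leftrightarrow> U\<close> for spaces \<open>V\<close> on \<open>X\<close> and \<open>U\<close> on \<open>Y\<close>;
  it is a space on \<open>(X - Y) \<union> (Y - X)\<close>.\<close>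

definition matched ::
  "'i set \<Rightarrow> 'i set \<Rightarrow> ('i \<Rightarrow> 'f::field) set \<Rightarrow> ('i \<Rightarrow> 'f) set \<Rightarrow> ('i \<Rightarrow> 'f) set" where
  "matched X Y V U =
     {restr (X - Y) g + restr (Y - X) h | g h. g \<in> V \<and> h \<in> U \<and> (\<forall>i\<in>X \<inter> Y. g i = h i)}"

definition orth :: "'i set \<Rightarrow> ('i \<Rightarrow> 'f::field) set \<Rightarrow> ('i \<Rightarrow> 'f) set" where
  "orth X V = {f \<in> vecs X. \<forall>g\<in>V. (\<Sum>i\<in>X. f i * g i) = 0}"

text \<open>
  In \<open>relabel bs V\<close>, an entry \<open>(X, s, \<phi>)\<close> of \<open>bs\<close> says that the block \<open>X\<close> is renamed to
  \<open>\<phi> ` X\<close> along \<open>\<phi>\<close> and that the component is multiplied by the sign \<open>s\<close>.  The blocks are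
  meant to be disjoint, the maps injective on them, and the new blocks disjoint.
\<close>

definition relabel :: "('i set \<times> 'f::field \<times> ('i \<Rightarrow> 'i)) list \<Rightarrow> ('i \<Rightarrow> 'f) set \<Rightarrow> ('i \<Rightarrow> 'f) set" where
  "relabel bs V =
     {g \<in> vecs (\<Union>(X, s, \<phi>)\<in>set bs. \<phi> ` X).
        \<exists>f\<in>V. \<forall>(X, s, \<phi>)\<in>set bs. \<forall>i\<in>X. g (\<phi> i) = s * f i}"

end

theory Submission
  imports Defs
begin

text \<open>
  The theorem is the implicit duality theorem for matched composition,
  \<open>(V \<leftrightarrow> U)\<^sup>\<bottom> = {(a on X - Y, b on Y - X) | a \<in> V\<^sup>\<bottom>, b \<in> U\<^sup>\<bottom>, a = -b on X \<inter> Y}\<close>,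
  followed by bookkeeping of names and signs.

  Duality (\<open>orth_matched\<close>) rests on one fact of linear algebra, that in finite dimension the
  orthogonal complement of an intersection is contained in the sum of the orthogonal complements
  (\<open>orth_Int_subset\<close>). Pull \<open>V\<close> and \<open>U\<close> back to the common index set \<open>X \<union> Y\<close>, leaving
  the new components free. Then \<open>V \<leftrightarrow> U\<close> is a projection of the intersection of the two pullbacks,
  and their complements are \<open>V\<^sup>\<bottom>\<close> and \<open>U\<^sup>\<bottom>\<close>, extended by zero. So a vector \<open>p\<close> that
  vanishes on \<open>X \<inter> Y\<close> and is orthogonal to \<open>V \<leftrightarrow> U\<close> is a sum \<open>a + b\<close> with \<open>a \<in> V\<^sup>\<bottom>\<close> and
  \<open>b \<in> U\<^sup>\<bottom>\<close>; that \<open>p\<close> vanishes on \<open>X \<inter> Y\<close> means \<open>a = -b\<close> there.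

  The signs in the adjoints are there to turn this skew matching \<open>a = -b\<close> into an ordinary one. All
  the relabellings use the same renaming \<open>\<tau>\<close> of labels, and on \<open>P\<close>, \<open>Pd\<close>, \<open>Mu\<close>, \<open>My\<close> they can be
  taken to use the same signs. On \<open>W\<close> and \<open>Wd\<close> the linkages get the sign opposite to that of the
  space they are composed with. The one mismatch is that the adjoint of \<open>V1\<close> carries the negatives
  of the signs wanted on both of its blocks, which does not change it, because a linear subspace is
  closed under negation. With the right signs, \<open>relabel_along_orth_matched\<close> gives both parts of the
  theorem; the second is the case without \<open>Mu\<close> and \<open>My\<close>.
\<close>

section \<open>Subspaces of vectors and orthogonal complements\<close>

lemma sum_apply_fun: "(\<Sum>i\<in>S. F i) j = (\<Sum>i\<in>S. F i j :: 'f::field)"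
  by (induction S rule: infinite_finite_induct) (auto simp: zero_fun_def)

text \<open>
  Extend a basis of \<open>U\<close> by \<open>f\<close> and take a linear functional that is 0 on the basis and 1 at \<open>f\<close>.
  On \<open>vecs S\<close> a functional is the dot product with its vector of values at the unit vectors.
\<close>

lemma separating_orth_vector:
  fixes U :: "('i \<Rightarrow> 'f::field) set"
  assumes S: "finite S" and U: "space_on S U" and f: "f \<in> vecs S" "f \<notin> U"
  shows "\<exists>g\<in>orth S U. (\<Sum>i\<in>S. g i * f i) \<noteq> 0"
proof -
  interpret pr: vector_space_pair "scale_vec :: 'f \<Rightarrow> ('i \<Rightarrow> 'f) \<Rightarrow> 'i \<Rightarrow> 'f" "(*) :: 'f \<Rightarrow> 'f \<Rightarrow> 'f"
    by unfold_locales (auto simp: algebra_simps)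
  have sub: "vec.subspace U" and UX: "U \<subseteq> vecs S" using U by (auto simp: space_on_def)
  obtain B where B: "B \<subseteq> U" "vec.independent B" "U \<subseteq> vec.span B"
    using vec.maximal_independent_subset[of U] by auto
  have spB: "vec.span B = U"
    using B sub by (metis vec.span_minimal subset_antisym)
  have "vec.independent (insert f B)"
    using B(2) f(2) spB by (simp add: vec.independent_insertI)
  then obtain \<phi> where lin: "Vector_Spaces.linear scale_vec (*) \<phi>"
      and \<phi>: "\<forall>x\<in>insert f B. \<phi> x = (if x = f then 1 else 0)"
    using pr.linear_independent_extend[of "insert f B" "\<lambda>x. if x = f then 1 else 0"] by blast
  interpret \<phi>: Vector_Spaces.linear "scale_vec :: 'f \<Rightarrow> ('i \<Rightarrow> 'f) \<Rightarrow> 'i \<Rightarrow> 'f" "(*)" \<phi> by (rule lin)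
  define e :: "'i \<Rightarrow> 'i \<Rightarrow> 'f" where "e i = (\<lambda>j. if j = i then 1 else 0)" for i
  define g where "g = restr S (\<lambda>i. \<phi> (e i))"
  have rep: "(\<Sum>i\<in>S. g i * x i) = \<phi> x" if x: "x \<in> vecs S" for x
  proof -
    have "x = (\<Sum>i\<in>S. scale_vec (x i) (e i))"
    proof
      fix j
      show "x j = (\<Sum>i\<in>S. scale_vec (x i) (e i)) j"
        using x S by (cases "j \<in> S")
          (auto simp: sum_apply_fun scale_vec_def e_def vecs_def if_distrib cong: if_cong)
    qed
    then have "\<phi> x = (\<Sum>i\<in>S. x i * \<phi> (e i))"
      by (metis (no_types, lifting) \<phi>.sum \<phi>.scale sum.cong)
    then show ?thesis by (simp add: g_def restr_def mult.commute)
  qed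
  have "\<phi> x = 0" if "x \<in> U" for x
  proof (rule pr.linear_eq_0_on_span[OF lin])
    show "x \<in> vec.span B" using that spB by simp
    fix b assume "b \<in> B"
    then show "\<phi> b = 0" using \<phi> B(1) f(2) by auto
  qed
  then have "g \<in> orth S U"
    using rep UX by (auto simp: orth_def g_def restr_def vecs_def subset_iff)
  moreover have "(\<Sum>i\<in>S. g i * f i) = 1" using rep f \<phi> by simp
  ultimately show ?thesis by (metis zero_neq_one)
qed

lemma space_on_0: "space_on X V \<Longrightarrow> 0 \<in> V"
  by (simp add: space_on_def vec.subspace_0)

lemma space_on_add: "space_on X V \<Longrightarrow> f \<in> V \<Longrightarrow> g \<in> V \<Longrightarrow> f + g \<in> V"
  by (simp add: space_on_def vec.subspace_add)

lemma space_on_uminus: "space_on X V \<Longrightarrow> f \<in> V \<Longrightarrow> - f \<in> V"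
  by (simp add: space_on_def vec.subspace_neg)

lemma space_on_vecs: "space_on X V \<Longrightarrow> f \<in> V \<Longrightarrow> f \<in> vecs X"
  by (auto simp: space_on_def)

lemma space_onI:
  assumes "V \<subseteq> vecs X" "0 \<in> V" "\<And>f g. f \<in> V \<Longrightarrow> g \<in> V \<Longrightarrow> f + g \<in> V"
    "\<And>c f. f \<in> V \<Longrightarrow> scale_vec c f \<in> V"
  shows "space_on X V"
  using assms by (simp add: space_on_def vec.subspace_def)

lemma space_on_orth: "space_on X (orth X V)"
  by (rule space_onI)
     (auto simp: orth_def vecs_def scale_vec_def distrib_right sum.distrib mult.assoc
        simp flip: sum_distrib_left)

lemma space_on_direct_sum:
  assumes V: "space_on X V" and U: "space_on Y U"
  shows "space_on (X \<union> Y) (V \<oplus> U)"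
proof (rule space_onI)
  show "V \<oplus> U \<subseteq> vecs (X \<union> Y)"
    using V U by (auto simp: direct_sum_def space_on_def vecs_def subset_iff)
  show "0 \<in> V \<oplus> U"
    unfolding direct_sum_def using space_on_0[OF V] space_on_0[OF U]
    by (intro CollectI exI[of _ 0]) simp
next
  fix f g assume "f \<in> V \<oplus> U" "g \<in> V \<oplus> U"
  then obtain a b c d where "f = a + b" "g = c + d" "a \<in> V" "b \<in> U" "c \<in> V" "d \<in> U"
    by (auto simp: direct_sum_def)
  then have "f + g = (a + c) + (b + d)" "a + c \<in> V" "b + d \<in> U"
    using space_on_add[OF V] space_on_add[OF U] by (auto simp: algebra_simps)
  then show "f + g \<in> V \<oplus> U" unfolding direct_sum_def by blast
next
  fix c f assume "f \<in> V \<oplus> U"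
  then obtain a b where "f = a + b" "a \<in> V" "b \<in> U" by (auto simp: direct_sum_def)
  then have "scale_vec c f = scale_vec c a + scale_vec c b" "scale_vec c a \<in> V" "scale_vec c b \<in> U"
    using V U by (auto simp: space_on_def vec.subspace_scale vec.scale_right_distrib)
  then show "scale_vec c f \<in> V \<oplus> U" unfolding direct_sum_def by blast
qed

lemma orth_orth_subset:
  assumes "finite S" "space_on S U"
  shows "orth S (orth S U) \<subseteq> U"
proof
  fix f assume f: "f \<in> orth S (orth S U)"
  then have "f \<in> vecs S" "\<forall>g\<in>orth S U. (\<Sum>i\<in>S. g i * f i) = 0"
    by (auto simp: orth_def mult.commute)
  then show "f \<in> U" using separating_orth_vector[OF assms] by blast
qed

text \<open>
  Suppose that \<open>f\<close> is orthogonal to \<open>V \<inter> U\<close> but not in \<open>V\<^sup>\<bottom> + U\<^sup>\<bottom>\<close>. A vector \<open>q\<close> that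
  separates \<open>f\<close> from this sum is orthogonal to both \<open>V\<^sup>\<bottom>\<close> and \<open>U\<^sup>\<bottom>\<close>, so it lies in \<open>V \<inter> U\<close>,
  where \<open>f\<close> pairs to zero with it.
\<close>

lemma orth_Int_subset:
  assumes S: "finite S" and V: "space_on S V" and U: "space_on S U"
  shows "orth S (V \<inter> U) \<subseteq> orth S V \<oplus> orth S U"
proof
  fix f assume f: "f \<in> orth S (V \<inter> U)"
  have sp: "space_on S (orth S V \<oplus> orth S U)"
    using space_on_direct_sum[of S "orth S V" S "orth S U"] by (simp add: space_on_orth)
  show "f \<in> orth S V \<oplus> orth S U"
  proof (rule ccontr)
    assume "f \<notin> orth S V \<oplus> orth S U"
    then obtain q where q: "q \<in> orth S (orth S V \<oplus> orth S U)" "(\<Sum>i\<in>S. q i * f i) \<noteq> 0"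
      using separating_orth_vector[OF S sp, of f] f unfolding orth_def[of S "V \<inter> U"] by blast
    have "orth S V \<subseteq> orth S V \<oplus> orth S U"
      unfolding direct_sum_def using space_on_0[OF space_on_orth] by (metis (mono_tags, lifting) add.right_neutral mem_Collect_eq subsetI)
    moreover have "orth S U \<subseteq> orth S V \<oplus> orth S U"
      unfolding direct_sum_def using space_on_0[OF space_on_orth] by (metis (mono_tags, lifting) add.left_neutral mem_Collect_eq subsetI)
    ultimately have "q \<in> orth S (orth S V)" "q \<in> orth S (orth S U)"
      using q(1) unfolding orth_def by blast+
    then have "q \<in> V \<inter> U" using orth_orth_subset[OF S] V U by blast
    then show False using f q(2) by (auto simp: orth_def mult.commute)
  qed
qed

section \<open>Duality for matched composition\<close>

text \<open>
  The pullback of \<open>V\<close> to the larger index set \<open>S\<close>, with free components outside \<open>X\<close>. Matching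
  becomes intersection after this pullback.
\<close>

definition cylinder :: "'i set \<Rightarrow> 'i set \<Rightarrow> ('i \<Rightarrow> 'f::field) set \<Rightarrow> ('i \<Rightarrow> 'f) set" where
  "cylinder S X V = {f \<in> vecs S. restr X f \<in> V}"

lemma space_on_cylinder:
  assumes "space_on X V"
  shows "space_on S (cylinder S X V)"
proof -
  have "restr X (0 :: 'a \<Rightarrow> 'b) = 0" "restr X (f + g) = restr X f + restr X g"
    "restr X (scale_vec c f) = scale_vec c (restr X f)" for f g :: "'a \<Rightarrow> 'b" and c
    by (auto simp: restr_def scale_vec_def)
  with assms show ?thesis
    by (intro space_onI)
       (auto simp: cylinder_def space_on_def vec.subspace_def, auto simp: vecs_def scale_vec_def)
qed

text \<open>
  The unit vectors at the labels in \<open>S - X\<close> belong to the cylinder and force a vector orthogonal to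
  it to vanish there.
\<close>

lemma orth_cylinder:
  assumes S: "finite S" "X \<subseteq> S" and V: "space_on X V"
  shows "orth S (cylinder S X V) \<subseteq> orth X V"
proof
  fix a assume a: "a \<in> orth S (cylinder S X V)"
  have sum0: "(\<Sum>i\<in>S. a i * f i) = 0" if "f \<in> vecs S" "restr X f \<in> V" for f
    using a that by (auto simp: orth_def cylinder_def)
  have "a j = 0" if j: "j \<notin> X" for j
  proof (cases "j \<in> S")
    case True
    define f :: "'a \<Rightarrow> 'b" where "f = (\<lambda>i. if i = j then 1 else 0)"
    have "restr X f = 0" using j by (auto simp: restr_def f_def)
    moreover have "f \<in> vecs S" using True by (auto simp: vecs_def f_def)
    ultimately have "(\<Sum>i\<in>S. a i * f i) = 0" using sum0 space_on_0[OF V] by simp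
    then show ?thesis using S True by (simp add: f_def if_distrib cong: if_cong)
  next
    case False
    then show ?thesis using a by (auto simp: orth_def vecs_def)
  qed
  moreover have "(\<Sum>i\<in>X. a i * g i) = 0" if g: "g \<in> V" for g
  proof -
    have gX: "g i = 0" if "i \<notin> X" for i using space_on_vecs[OF V g] that by (simp add: vecs_def)
    then have "restr X g = g" by (auto simp: restr_def)
    moreover have "g \<in> vecs S" using gX S by (auto simp: vecs_def)
    ultimately have "(\<Sum>i\<in>S. a i * g i) = 0" using sum0 g by simp
    moreover have "(\<Sum>i\<in>X. a i * g i) = (\<Sum>i\<in>S. a i * g i)"
      using S gX by (intro sum.mono_neutral_left) auto
    ultimately show ?thesis by simp
  qed
  ultimately show "a \<in> orth X V" by (auto simp: orth_def vecs_def)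
qed

text \<open>
  The minus sign in \<open>a i = - b i\<close> makes the contributions of \<open>X \<inter> Y\<close> to the dot products
  \<open>\<langle>a, g\<rangle>\<close> and \<open>\<langle>b, h\<rangle>\<close> cancel when \<open>g\<close> and \<open>h\<close> match, which gives one inclusion. The other one
  needs finite dimension, through \<open>orth_Int_subset\<close>.
\<close>

lemma orth_matched:
  assumes fin: "finite X" "finite Y" and V: "space_on X V" and U: "space_on Y U"
  defines "D \<equiv> (X - Y) \<union> (Y - X)"
  shows "orth D (matched X Y V U) =
    {restr (X - Y) a + restr (Y - X) b | a b. a \<in> orth X V \<and> b \<in> orth Y U \<and> (\<forall>i\<in>X \<inter> Y. a i = - b i)}"
    (is "_ = ?R")
proof
  define S where "S = X \<union> Y"
  have S: "finite S" "X \<subseteq> S" "Y \<subseteq> S" "D \<subseteq> S" using fin by (auto simp: S_def D_def)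
  show "orth D (matched X Y V U) \<subseteq> ?R"
  proof
    fix p assume p: "p \<in> orth D (matched X Y V U)"
    have pD: "p i = 0" if "i \<notin> D" for i using p that by (simp add: orth_def vecs_def)
    have "p \<in> orth S (cylinder S X V \<inter> cylinder S Y U)"
    proof -
      have "(\<Sum>i\<in>S. p i * f i) = 0" if f: "f \<in> cylinder S X V \<inter> cylinder S Y U" for f
      proof -
        have m: "restr (X - Y) (restr X f) + restr (Y - X) (restr Y f) \<in> matched X Y V U"
          unfolding matched_def using f
          by (intro CollectI exI[of _ "restr X f"] exI[of _ "restr Y f"])
             (auto simp: cylinder_def restr_def)
        have eq: "restr (X - Y) (restr X f) + restr (Y - X) (restr Y f) = restr D f"
          by (auto simp: restr_def D_def fun_eq_iff)
        have "(\<Sum>i\<in>D. p i * restr D f i) = 0"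
          using p m unfolding eq by (simp add: orth_def)
        then have "(\<Sum>i\<in>D. p i * f i) = 0"
          by (simp add: restr_def)
        moreover have "(\<Sum>i\<in>D. p i * f i) = (\<Sum>i\<in>S. p i * f i)"
          using S pD by (intro sum.mono_neutral_left) auto
        ultimately show ?thesis by simp
      qed
      moreover have "p \<in> vecs S" using pD S(4) by (force simp: vecs_def)
      ultimately show ?thesis by (simp add: orth_def)
    qed
    \<comment> \<open>\<open>a\<close> and \<open>b\<close> cancel on \<open>X \<inter> Y\<close> because \<open>p\<close> vanishes there.\<close>
    then obtain a b where ab: "p = a + b" "a \<in> orth X V" "b \<in> orth Y U"
      using orth_Int_subset[OF S(1) space_on_cylinder[OF V] space_on_cylinder[OF U]]
        orth_cylinder[OF S(1,2) V] orth_cylinder[OF S(1,3) U]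
      by (fastforce simp: direct_sum_def)
    have "a i = - b i" if "i \<in> X \<inter> Y" for i
    proof -
      have "a i + b i = 0" using pD[of i] that by (auto simp: ab(1) D_def)
      then show ?thesis by (simp add: eq_neg_iff_add_eq_0)
    qed
    moreover have "p = restr (X - Y) a + restr (Y - X) b"
    proof
      fix i
      have "a i = 0" if "i \<notin> X" using ab that by (simp add: orth_def vecs_def)
      moreover have "b i = 0" if "i \<notin> Y" using ab that by (simp add: orth_def vecs_def)
      moreover note pD[of i] ab(1)
      ultimately show "p i = (restr (X - Y) a + restr (Y - X) b) i"
        by (auto simp: restr_def D_def)
    qed
    ultimately show "p \<in> ?R" using ab by blast
  qed
  show "?R \<subseteq> orth D (matched X Y V U)"
  proof
    fix p assume "p \<in> ?R"
    then obtain a b where p: "p = restr (X - Y) a + restr (Y - X) b"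
      and ab: "a \<in> orth X V" "b \<in> orth Y U" "\<forall>i\<in>X \<inter> Y. a i = - b i" by blast
    have "(\<Sum>i\<in>D. p i * q i) = 0" if m: "q \<in> matched X Y V U" for q
    proof -
      obtain g h where q: "q = restr (X - Y) g + restr (Y - X) h" "g \<in> V" "h \<in> U"
        "\<forall>i\<in>X \<inter> Y. g i = h i" using m unfolding matched_def by blast
      have "(\<Sum>i\<in>D. p i * q i) = (\<Sum>i\<in>X - Y. a i * g i) + (\<Sum>i\<in>Y - X. b i * h i)"
        unfolding D_def using fin
        by (subst sum.union_disjoint) (auto simp: p q(1) restr_def intro!: arg_cong2[of _ _ _ _ "(+)"] sum.cong)
      moreover have "(\<Sum>i\<in>X. a i * g i) = (\<Sum>i\<in>X - Y. a i * g i) + (\<Sum>i\<in>X \<inter> Y. a i * g i)"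
        using fin by (subst sum.union_disjoint[symmetric]) (auto intro!: sum.cong)
      moreover have "(\<Sum>i\<in>Y. b i * h i) = (\<Sum>i\<in>Y - X. b i * h i) + (\<Sum>i\<in>X \<inter> Y. b i * h i)"
        using fin by (subst sum.union_disjoint[symmetric]) (auto intro!: sum.cong)
      moreover have "(\<Sum>i\<in>X \<inter> Y. a i * g i) = - (\<Sum>i\<in>X \<inter> Y. b i * h i)"
        using ab(3) q(4) by (simp add: sum_negf)
      moreover have "(\<Sum>i\<in>X. a i * g i) = 0" "(\<Sum>i\<in>Y. b i * h i) = 0"
        using ab q by (auto simp: orth_def)
      ultimately show ?thesis by (simp add: add.commute)
    qed
    moreover have "p \<in> vecs D" by (auto simp: p vecs_def restr_def D_def)
    ultimately show "p \<in> orth D (matched X Y V U)" by (simp add: orth_def)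
  qed
qed

text \<open>
  For disjoint index sets there is nothing to match: the direct sum is a matched composition, and
  the sign condition in \<open>orth_matched\<close> is void.
\<close>

lemma orth_direct_sum:
  assumes fin: "finite X" "finite Y" and disj: "X \<inter> Y = {}"
    and V: "space_on X V" and U: "space_on Y U"
  shows "orth (X \<union> Y) (V \<oplus> U) = orth X V \<oplus> orth Y U"
proof -
  have r: "restr Z f = f" if "f \<in> vecs Z" for Z and f :: "'a \<Rightarrow> 'b"
    using that by (auto simp: restr_def vecs_def)
  have d: "X - Y = X" "Y - X = Y" using disj by auto
  have m: "matched X Y A B = A \<oplus> B" if "A \<subseteq> vecs X" "B \<subseteq> vecs Y" for A B :: "('a \<Rightarrow> 'b) set"
    proof -
    have "restr X g = g" "restr Y h = h" if "g \<in> A" "h \<in> B" for g h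
      using that \<open>A \<subseteq> vecs X\<close> \<open>B \<subseteq> vecs Y\<close> r by blast+
    then show ?thesis
      unfolding matched_def direct_sum_def d disj by (intro Collect_cong) (metis empty_iff)
  qed
  have o: "orth X V \<subseteq> vecs X" "orth Y U \<subseteq> vecs Y" by (auto simp: orth_def)
  have vu: "matched X Y V U = V \<oplus> U" using V U by (intro m) (auto simp: space_on_def)
  have "orth (X \<union> Y) (V \<oplus> U) = matched X Y (orth X V) (orth Y U)"
    using orth_matched[OF fin V U] unfolding d disj vu by (simp add: matched_def d disj)
  then show ?thesis using m[OF o] by simp
qed

section \<open>Signed relabelling along one map\<close>

text \<open>
  Here all blocks are renamed by one map \<open>\<tau>\<close>, and the sign depends on the label, so that relabellings
  of spaces on overlapping index sets can be compared. The signs may be arbitrary factors; a zero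
  factor loses a component.
\<close>

definition relabel_along ::
  "'i set \<Rightarrow> ('i \<Rightarrow> 'f::field) \<Rightarrow> ('i \<Rightarrow> 'i) \<Rightarrow> ('i \<Rightarrow> 'f) set \<Rightarrow> ('i \<Rightarrow> 'f) set" where
  "relabel_along X \<epsilon> \<tau> V = {g \<in> vecs (\<tau> ` X). \<exists>f\<in>V. \<forall>i\<in>X. g (\<tau> i) = \<epsilon> i * f i}"

lemma relabel_eq_relabel_along:
  assumes "\<And>B s \<phi> i. (B, s, \<phi>) \<in> set bs \<Longrightarrow> i \<in> B \<Longrightarrow> \<phi> i = \<tau> i \<and> s = \<epsilon> i"
    and X: "X = (\<Union>(B, s, \<phi>)\<in>set bs. B)"
  shows "relabel bs V = relabel_along X \<epsilon> \<tau> V"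
proof -
  have "(\<Union>(B, s, \<phi>)\<in>set bs. \<phi> ` B) = (\<Union>(B, s, \<phi>)\<in>set bs. \<tau> ` B)"
    using assms(1) by (intro SUP_cong refl) (auto intro!: image_cong)
  also have "\<dots> = \<tau> ` X" unfolding X by (auto simp: image_iff split_beta)
  finally have "(\<Union>(B, s, \<phi>)\<in>set bs. \<phi> ` B) = \<tau> ` X" .
  moreover have "(\<forall>(B, s, \<phi>)\<in>set bs. \<forall>i\<in>B. g (\<phi> i) = s * f i) \<longleftrightarrow> (\<forall>i\<in>X. g (\<tau> i) = \<epsilon> i * f i)"
    for f g :: "'a \<Rightarrow> 'b"
  proof -
    have "(\<forall>(B, s, \<phi>)\<in>set bs. \<forall>i\<in>B. g (\<phi> i) = s * f i) \<longleftrightarrow>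
        (\<forall>(B, s, \<phi>)\<in>set bs. \<forall>i\<in>B. g (\<tau> i) = \<epsilon> i * f i)"
      using assms(1) by (intro ball_cong refl) auto
    also have "\<dots> \<longleftrightarrow> (\<forall>i\<in>X. g (\<tau> i) = \<epsilon> i * f i)"
      unfolding X by (auto simp: split_beta)
    finally show ?thesis .
  qed
  ultimately show ?thesis unfolding relabel_def relabel_along_def by simp
qed

lemma relabel_along_uminus:
  assumes "space_on X V"
  shows "relabel_along X (\<lambda>i. - \<epsilon> i) \<tau> V = relabel_along X \<epsilon> \<tau> V"
proof -
  have "(\<exists>f\<in>V. \<forall>i\<in>X. g (\<tau> i) = - \<epsilon> i * f i) \<longleftrightarrow> (\<exists>f\<in>V. \<forall>i\<in>X. g (\<tau> i) = \<epsilon> i * f i)" for g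
  proof -
    have "\<exists>f'\<in>V. \<forall>i\<in>X. g (\<tau> i) = s i * f' i" if "f \<in> V" "\<forall>i\<in>X. g (\<tau> i) = - s i * f i" for f s
      using that space_on_uminus[OF assms] by (intro bexI[of _ "- f"]) auto
    from this[of _ \<epsilon>] this[of _ "\<lambda>i. - \<epsilon> i"] show ?thesis by auto
  qed
  then show ?thesis by (simp add: relabel_along_def)
qed

text \<open>
  For an injective \<open>\<tau>\<close> a relabelled space is an image under the following map of vectors, which
  reduces identities between relabelled spaces to identities between vectors.
\<close>

definition pushforward :: "'i set \<Rightarrow> ('i \<Rightarrow> 'f::field) \<Rightarrow> ('i \<Rightarrow> 'i) \<Rightarrow> ('i \<Rightarrow> 'f) \<Rightarrow> 'i \<Rightarrow> 'f" where
  "pushforward X \<epsilon> \<tau> f = restr (\<tau> ` X) (\<lambda>j. \<epsilon> (inv_into X \<tau> j) * f (inv_into X \<tau> j))"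

lemma pushforward_apply: "inj_on \<tau> X \<Longrightarrow> i \<in> X \<Longrightarrow> pushforward X \<epsilon> \<tau> f (\<tau> i) = \<epsilon> i * f i"
  by (simp add: pushforward_def restr_def)

lemma pushforward_outside: "j \<notin> \<tau> ` X \<Longrightarrow> pushforward X \<epsilon> \<tau> f j = 0"
  by (simp add: pushforward_def restr_def)

lemma relabel_along_eq_image:
  assumes "inj_on \<tau> X"
  shows "relabel_along X \<epsilon> \<tau> V = pushforward X \<epsilon> \<tau> ` V"
proof (intro equalityI subsetI)
  fix g assume "g \<in> relabel_along X \<epsilon> \<tau> V"
  then obtain f where g: "g \<in> vecs (\<tau> ` X)" and f: "f \<in> V" "\<forall>i\<in>X. g (\<tau> i) = \<epsilon> i * f i"
    by (auto simp: relabel_along_def)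
  have "g j = pushforward X \<epsilon> \<tau> f j" for j
    using g f(2) assms by (cases "j \<in> \<tau> ` X") (auto simp: pushforward_apply pushforward_outside vecs_def)
  then show "g \<in> pushforward X \<epsilon> \<tau> ` V" using f(1) by blast
next
  fix g assume "g \<in> pushforward X \<epsilon> \<tau> ` V"
  then show "g \<in> relabel_along X \<epsilon> \<tau> V"
    using assms by (force simp: relabel_along_def vecs_def pushforward_apply pushforward_outside)
qed

text \<open>
  The signs on \<open>X \<inter> Y\<close> disappear from the result and survive only as a twist of the matching
  condition.
\<close>

lemma matched_relabel_along:
  assumes inj: "inj_on \<tau> (X \<union> Y)"
    and \<epsilon>: "\<And>i. i \<in> X - Y \<Longrightarrow> \<epsilon> i = \<delta> i" "\<And>i. i \<in> Y - X \<Longrightarrow> \<epsilon>' i = \<delta> i"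
  shows "matched (\<tau> ` X) (\<tau> ` Y) (relabel_along X \<epsilon> \<tau> A) (relabel_along Y \<epsilon>' \<tau> B) =
    relabel_along ((X - Y) \<union> (Y - X)) \<delta> \<tau>
      {restr (X - Y) a + restr (Y - X) b | a b. a \<in> A \<and> b \<in> B \<and> (\<forall>i\<in>X \<inter> Y. \<epsilon> i * a i = \<epsilon>' i * b i)}"
proof -
  let ?D = "(X - Y) \<union> (Y - X)"
  let ?p = "pushforward X \<epsilon> \<tau>" and ?q = "pushforward Y \<epsilon>' \<tau>" and ?r = "pushforward ?D \<delta> \<tau>"
  have injs: "inj_on \<tau> X" "inj_on \<tau> Y" "inj_on \<tau> ?D" using inj by (auto intro: inj_on_subset)
  have im: "\<tau> ` X \<inter> \<tau> ` Y = \<tau> ` (X \<inter> Y)" "\<tau> ` X - \<tau> ` Y = \<tau> ` (X - Y)" "\<tau> ` Y - \<tau> ` X = \<tau> ` (Y - X)"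
    using inj by (auto simp: inj_on_def)
  have mem: "\<tau> i \<in> \<tau> ` Z \<longleftrightarrow> i \<in> Z" if "i \<in> X \<union> Y" "Z \<subseteq> X \<union> Y" for i Z
    using inj that by (auto simp: inj_on_def)
  have agree: "(\<forall>j\<in>\<tau> ` X \<inter> \<tau> ` Y. ?p a j = ?q b j) \<longleftrightarrow> (\<forall>i\<in>X \<inter> Y. \<epsilon> i * a i = \<epsilon>' i * b i)" for a b
    unfolding im using injs by (auto simp: pushforward_apply)
  have join: "restr (\<tau> ` X - \<tau> ` Y) (?p a) + restr (\<tau> ` Y - \<tau> ` X) (?q b) =
      ?r (restr (X - Y) a + restr (Y - X) b)" (is "?l = _") for a b
  proof
    fix j
    show "?l j = ?r (restr (X - Y) a + restr (Y - X) b) j"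
    proof (cases "j \<in> \<tau> ` ?D")
      case True
      then obtain i where "i \<in> ?D" "j = \<tau> i" by blast
      then show ?thesis unfolding im
        using injs \<epsilon> mem[of i "X - Y"] mem[of i "Y - X"]
        by (auto simp: restr_def pushforward_apply)
    next
      case False
      then show ?thesis unfolding im by (auto simp: restr_def pushforward_outside)
    qed
  qed
  show ?thesis
    unfolding relabel_along_eq_image[OF injs(1)] relabel_along_eq_image[OF injs(2)]
      relabel_along_eq_image[OF injs(3)] matched_def
  proof (intro equalityI subsetI, goal_cases)
    case (1 x)
    then obtain a b where "a \<in> A" "b \<in> B" "\<forall>j\<in>\<tau> ` X \<inter> \<tau> ` Y. ?p a j = ?q b j"
      "x = restr (\<tau> ` X - \<tau> ` Y) (?p a) + restr (\<tau> ` Y - \<tau> ` X) (?q b)" by blast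
    then show ?case unfolding agree join by blast
  next
    case (2 x)
    then obtain a b where "a \<in> A" "b \<in> B" "\<forall>i\<in>X \<inter> Y. \<epsilon> i * a i = \<epsilon>' i * b i"
      "x = ?r (restr (X - Y) a + restr (Y - X) b)" by blast
    then show ?case unfolding agree[symmetric] join[symmetric] by blast
  qed
qed

lemma direct_sum_relabel_along:
  assumes inj: "inj_on \<tau> (X \<union> Y)" and disj: "X \<inter> Y = {}" and A: "A \<subseteq> vecs X" and B: "B \<subseteq> vecs Y"
  shows "relabel_along (X \<union> Y) \<epsilon> \<tau> (A \<oplus> B) = relabel_along X \<epsilon> \<tau> A \<oplus> relabel_along Y \<epsilon> \<tau> B"
proof -
  have injs: "inj_on \<tau> X" "inj_on \<tau> Y" using inj by (auto intro: inj_on_subset)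
  have mem: "\<tau> i \<in> \<tau> ` Z \<longleftrightarrow> i \<in> Z" if "i \<in> X \<union> Y" "Z \<subseteq> X \<union> Y" for i Z
    using inj that by (auto simp: inj_on_def)
  have split: "pushforward (X \<union> Y) \<epsilon> \<tau> (a + b) = pushforward X \<epsilon> \<tau> a + pushforward Y \<epsilon> \<tau> b"
    if ab: "a \<in> A" "b \<in> B" for a b
  proof
    fix j
    have z: "i \<notin> X \<Longrightarrow> a i = 0" "i \<notin> Y \<Longrightarrow> b i = 0" for i
      using ab A B by (auto simp: vecs_def)
    show "pushforward (X \<union> Y) \<epsilon> \<tau> (a + b) j = (pushforward X \<epsilon> \<tau> a + pushforward Y \<epsilon> \<tau> b) j"
    proof (cases "j \<in> \<tau> ` (X \<union> Y)")
      case True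
      then obtain i where i: "i \<in> X \<union> Y" "j = \<tau> i" by blast
      consider "i \<in> X" "i \<notin> Y" "\<tau> i \<notin> \<tau> ` Y" | "i \<in> Y" "i \<notin> X" "\<tau> i \<notin> \<tau> ` X"
        using i(1) disj mem[of i X] mem[of i Y] by blast
      then show ?thesis unfolding i(2)
        by cases (simp_all add: i(1) injs inj z pushforward_apply pushforward_outside)
    next
      case False
      then show ?thesis by (simp add: pushforward_outside image_Un)
    qed
  qed
  show ?thesis
    unfolding relabel_along_eq_image[OF inj] relabel_along_eq_image[OF injs(1)]
      relabel_along_eq_image[OF injs(2)] direct_sum_def
  proof (intro equalityI subsetI, goal_cases)
    case (1 x)
    then show ?case using split by blast
  next
    case (2 x)
    then obtain a b where "a \<in> A" "b \<in> B" "x = pushforward X \<epsilon> \<tau> a + pushforward Y \<epsilon> \<tau> b" by blast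
    then have "x = pushforward (X \<union> Y) \<epsilon> \<tau> (a + b)" using split by simp
    then show ?case using \<open>a \<in> A\<close> \<open>b \<in> B\<close> by blast
  qed
qed

section \<open>The adjoint of a matched composition\<close>

text \<open>
  Opposite nonzero factors on \<open>X \<inter> Y\<close> turn the skew matching of \<open>orth_matched\<close> into ordinary matching.
\<close>

lemma relabel_along_orth_matched:
  assumes fin: "finite X" "finite Y" and V: "space_on X V" and U: "space_on Y U"
    and inj: "inj_on \<tau> (X \<union> Y)"
    and \<epsilon>: "\<And>i. i \<in> X - Y \<Longrightarrow> \<epsilon> i = \<delta> i" "\<And>i. i \<in> X \<inter> Y \<Longrightarrow> \<epsilon> i = - \<delta> i"
    and nz: "\<And>i. \<delta> i \<noteq> 0"
  shows "relabel_along ((X - Y) \<union> (Y - X)) \<delta> \<tau> (orth ((X - Y) \<union> (Y - X)) (matched X Y V U)) =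
    matched (\<tau> ` X) (\<tau> ` Y) (relabel_along X \<epsilon> \<tau> (orth X V)) (relabel_along Y \<delta> \<tau> (orth Y U))"
proof -
  have "(\<forall>i\<in>X \<inter> Y. \<epsilon> i * a i = \<delta> i * b i) \<longleftrightarrow> (\<forall>i\<in>X \<inter> Y. a i = - b i)" for a b
  proof -
    have "\<epsilon> i * a i = \<delta> i * b i \<longleftrightarrow> a i = - b i" if "i \<in> X \<inter> Y" for i
    proof -
      have "\<epsilon> i * a i = \<delta> i * (- a i)" using \<epsilon>(2)[OF that] by simp
      then show ?thesis using nz[of i] by (metis minus_minus mult_left_cancel)
    qed
    then show ?thesis by blast
  qed
  then show ?thesis
    unfolding orth_matched[OF fin V U] by (subst matched_relabel_along[OF inj, of \<epsilon> \<delta> \<delta>]) (simp_all add: \<epsilon>)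
qed

theorem theorem70:
  fixes W Wd P Pd Mu My :: "'i set"
    and W' Wd' P' Pd' Mu' My' :: "'i set"
    and dW dP cW cWd cP cPd cMu cMy :: "'i \<Rightarrow> 'i"
    and V1 V2 VWM VPM VW VP :: "('i \<Rightarrow> 'f::field) set"
    and V1t V2t VWMt VPMt VWt VPt :: "('i \<Rightarrow> 'f) set"
  assumes fin: "finite W" "finite P" "finite Mu" "finite My"
    and disj: "sorted_wrt disjnt [W, Wd, P, Pd, Mu, My, W', Wd', P', Pd', Mu', My']"
    and dW: "bij_betw dW W Wd" and dP: "bij_betw dP P Pd"
    and cW: "bij_betw cW W W'" and cWd: "bij_betw cWd W Wd'"
    and cP: "bij_betw cP P P'" and cPd: "bij_betw cPd P Pd'"
    and cMu: "bij_betw cMu My Mu'" and cMy: "bij_betw cMy Mu My'"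
    and V1: "space_on (W \<union> P) V1" and V2: "space_on (Wd \<union> Pd) V2"
    and VWM: "space_on (W \<union> Wd \<union> Mu \<union> My) VWM"
    and VPM: "space_on (P \<union> Pd \<union> Mu \<union> My) VPM"
    and VW: "space_on (W \<union> Wd) VW"
    and VP: "space_on (P \<union> Pd) VP"
    and V1t: "V1t = relabel [(Wd, -1, cW \<circ> inv_into W dW), (Pd, 1, cP \<circ> inv_into P dP)]
                      (orth (Wd \<union> Pd) V2)"
    and V2t: "V2t = relabel [(W, -1, cWd), (P, 1, cPd)] (orth (W \<union> P) V1)"
    and VWMt: "VWMt = relabel [(W, -1, cWd), (Wd, 1, cW \<circ> inv_into W dW),
                               (Mu, -1, cMy), (My, 1, cMu)]
                        (orth (W \<union> Wd \<union> Mu \<union> My) VWM)"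
    and VPMt: "VPMt = relabel [(P, -1, cPd), (Pd, 1, cP \<circ> inv_into P dP),
                               (Mu, -1, cMy), (My, 1, cMu)]
                        (orth (P \<union> Pd \<union> Mu \<union> My) VPM)"
    and VWt: "VWt = relabel [(W, -1, cWd), (Wd, 1, cW \<circ> inv_into W dW)] (orth (W \<union> Wd) VW)"
    and VPt: "VPt = relabel [(P, -1, cPd), (Pd, 1, cP \<circ> inv_into P dP)] (orth (P \<union> Pd) VP)"
  shows "(VPM = matched (W \<union> P \<union> Wd \<union> Pd) (W \<union> Wd \<union> Mu \<union> My) (V1 \<oplus> V2) VWM \<longrightarrow>
          VPMt = matched (W' \<union> P' \<union> Wd' \<union> Pd') (W' \<union> Wd' \<union> Mu' \<union> My') (V1t \<oplus> V2t) VWMt) \<and>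
         (VP = matched (W \<union> P \<union> Wd \<union> Pd) (W \<union> Wd) (V1 \<oplus> V2) VW \<longrightarrow>
          VPt = matched (W' \<union> P' \<union> Wd' \<union> Pd') (W' \<union> Wd') (V1t \<oplus> V2t) VWt)"
proof -
  \<comment> \<open>\<open>\<sigma>\<close> holds the signs for the spaces with blocks \<open>Mu\<close>, \<open>My\<close> and for \<open>VW\<close> and \<open>VP\<close>;
    \<open>\<epsilon>\<close> the signs for the linkages, those of \<open>V1\<close> after the change of overall sign.\<close>
  define \<sigma> :: "'i \<Rightarrow> 'f" where "\<sigma> i = (if i \<in> Wd \<union> Pd \<union> My then 1 else - 1)" for i
  define \<epsilon> :: "'i \<Rightarrow> 'f" where "\<epsilon> i = (if i \<in> W \<union> Wd then - \<sigma> i else \<sigma> i)" for i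
  define \<tau> where "\<tau> i =
    (if i \<in> W then cWd i else if i \<in> Wd then (cW \<circ> inv_into W dW) i
     else if i \<in> P then cPd i else if i \<in> Pd then (cP \<circ> inv_into P dP) i
     else if i \<in> Mu then cMy i else cMu i)" for i
  let ?X = "W \<union> P \<union> Wd \<union> Pd"
  have ds: "W \<inter> Wd = {}" "W \<inter> P = {}" "W \<inter> Pd = {}" "W \<inter> Mu = {}" "W \<inter> My = {}"
    "Wd \<inter> P = {}" "Wd \<inter> Pd = {}" "Wd \<inter> Mu = {}" "Wd \<inter> My = {}"
    "P \<inter> Pd = {}" "P \<inter> Mu = {}" "P \<inter> My = {}" "Pd \<inter> Mu = {}" "Pd \<inter> My = {}" "Mu \<inter> My = {}"
    and ds': "Wd' \<inter> W' = {}" "(Wd' \<union> W') \<inter> Pd' = {}" "(Wd' \<union> W' \<union> Pd') \<inter> P' = {}"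
    "(Wd' \<union> W' \<union> Pd' \<union> P') \<inter> My' = {}" "(Wd' \<union> W' \<union> Pd' \<union> P' \<union> My') \<inter> Mu' = {}"
    using disj by (simp_all add: disjnt_def Int_Un_distrib Int_Un_distrib2 Int_commute)
  have on: "i \<in> W \<Longrightarrow> \<tau> i = cWd i" "i \<in> Wd \<Longrightarrow> \<tau> i = (cW \<circ> inv_into W dW) i"
    "i \<in> P \<Longrightarrow> \<tau> i = cPd i" "i \<in> Pd \<Longrightarrow> \<tau> i = (cP \<circ> inv_into P dP) i"
    "i \<in> Mu \<Longrightarrow> \<tau> i = cMy i" "i \<in> My \<Longrightarrow> \<tau> i = cMu i" for i
    unfolding \<tau>_def using ds by auto
  have \<sigma>: "i \<in> W \<union> P \<union> Mu \<Longrightarrow> \<sigma> i = - 1" "i \<in> Wd \<union> Pd \<union> My \<Longrightarrow> \<sigma> i = 1" for i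
    unfolding \<sigma>_def using ds by auto
  have \<epsilon>: "i \<in> Wd \<union> P \<Longrightarrow> \<epsilon> i = - 1" "i \<in> W \<union> Pd \<Longrightarrow> \<epsilon> i = 1" for i
    unfolding \<epsilon>_def \<sigma>_def using ds by auto
  have bW: "bij_betw \<tau> W Wd'" and bP: "bij_betw \<tau> P Pd'"
    and bMu: "bij_betw \<tau> Mu My'" and bMy: "bij_betw \<tau> My Mu'"
    and bWd: "bij_betw \<tau> Wd W'" and bPd: "bij_betw \<tau> Pd P'"
    using cWd cPd cMy cMu bij_betw_trans[OF bij_betw_inv_into[OF dW] cW]
      bij_betw_trans[OF bij_betw_inv_into[OF dP] cP]
    by (simp_all add: on cong: bij_betw_cong)
  have inj: "inj_on \<tau> (W \<union> Wd \<union> P \<union> Pd \<union> Mu \<union> My)"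
    using bij_betw_combine[OF bij_betw_combine[OF bij_betw_combine[OF bij_betw_combine[OF
      bij_betw_combine[OF bW bWd ds'(1)] bP ds'(2)] bPd ds'(3)] bMu ds'(4)] bMy ds'(5)]
    by (rule bij_betw_imp_inj_on)
  have im: "\<tau> ` W = Wd'" "\<tau> ` Wd = W'" "\<tau> ` P = Pd'" "\<tau> ` Pd = P'" "\<tau> ` Mu = My'" "\<tau> ` My = Mu'"
    using bW bWd bP bPd bMu bMy by (auto simp: bij_betw_def)
  have fin': "finite Wd" "finite Pd" using fin dW dP bij_betw_finite by blast+
  have V1t': "V1t = relabel_along (Wd \<union> Pd) \<epsilon> \<tau> (orth (Wd \<union> Pd) V2)"
    unfolding V1t by (rule relabel_eq_relabel_along) (auto simp: on \<epsilon>)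
  have "V2t = relabel_along (W \<union> P) (\<lambda>i. - \<epsilon> i) \<tau> (orth (W \<union> P) V1)"
    unfolding V2t by (rule relabel_eq_relabel_along) (auto simp: on \<epsilon>)
  \<comment> \<open>A subspace equals its negative, so both signs of the adjoint of \<open>V1\<close> can be flipped.\<close>
  then have V2t': "V2t = relabel_along (W \<union> P) \<epsilon> \<tau> (orth (W \<union> P) V1)"
    by (simp add: relabel_along_uminus[OF space_on_orth])
  have V12: "space_on ?X (V1 \<oplus> V2)"
    using space_on_direct_sum[OF V1 V2] by (simp add: Un_assoc)
  have "orth ((W \<union> P) \<union> (Wd \<union> Pd)) (V1 \<oplus> V2) = orth (W \<union> P) V1 \<oplus> orth (Wd \<union> Pd) V2"
    using fin fin' ds by (intro orth_direct_sum V1 V2) auto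
  moreover have "relabel_along ((W \<union> P) \<union> (Wd \<union> Pd)) \<epsilon> \<tau> (orth (W \<union> P) V1 \<oplus> orth (Wd \<union> Pd) V2) = V2t \<oplus> V1t"
    unfolding V1t' V2t' using ds
    by (intro direct_sum_relabel_along inj_on_subset[OF inj]) (auto simp: orth_def)
  moreover have "V2t \<oplus> V1t = V1t \<oplus> V2t"
    unfolding direct_sum_def using add.commute by (intro Collect_cong) blast
  ultimately have V12t: "relabel_along ?X \<epsilon> \<tau> (orth ?X (V1 \<oplus> V2)) = V1t \<oplus> V2t"
    by (simp add: Un_assoc)
  \<comment> \<open>\<open>M = Mu \<union> My\<close> gives the first part, \<open>M = {}\<close> the second.\<close>
  have core: "relabel_along (P \<union> Pd \<union> M) \<sigma> \<tau>
        (orth (P \<union> Pd \<union> M) (matched ?X (W \<union> Wd \<union> M) (V1 \<oplus> V2) U)) =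
      matched (W' \<union> P' \<union> Wd' \<union> Pd') (W' \<union> Wd' \<union> \<tau> ` M) (V1t \<oplus> V2t)
        (relabel_along (W \<union> Wd \<union> M) \<sigma> \<tau> (orth (W \<union> Wd \<union> M) U))"
    if M: "M \<subseteq> Mu \<union> My" and U: "space_on (W \<union> Wd \<union> M) U" for M U
  proof -
    let ?Y = "W \<union> Wd \<union> M"
    have "(Mu \<union> My) \<inter> ?X = {}" and P_disj: "(P \<union> Pd) \<inter> (W \<union> Wd) = {}"
      using ds by (simp_all add: Int_Un_distrib Int_Un_distrib2 Int_commute)
    then have M_disj: "M \<inter> ?X = {}" using M by blast
    have D: "(?X - ?Y) \<union> (?Y - ?X) = P \<union> Pd \<union> M" using P_disj M_disj by blast
    have imX: "\<tau> ` ?X = W' \<union> P' \<union> Wd' \<union> Pd'" by (auto simp: image_Un im)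
    have imY: "\<tau> ` ?Y = W' \<union> Wd' \<union> \<tau> ` M" by (auto simp: image_Un im)
    have "finite M" using M fin by (meson finite_UnI finite_subset)
    then have fXY: "finite ?X" "finite ?Y" using fin fin' by auto
    show ?thesis
      unfolding imX[symmetric] imY[symmetric] V12t[symmetric] D[symmetric]
    proof (rule relabel_along_orth_matched[OF fXY V12 U])
      show "inj_on \<tau> (?X \<union> ?Y)" using M by (intro inj_on_subset[OF inj]) auto
      show "\<epsilon> i = \<sigma> i" if "i \<in> ?X - ?Y" for i using that by (simp add: \<epsilon>_def)
      show "\<epsilon> i = - \<sigma> i" if "i \<in> ?X \<inter> ?Y" for i
        using that M_disj by (auto simp: \<epsilon>_def)
      show "\<sigma> i \<noteq> 0" for i by (simp add: \<sigma>_def)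
    qed
  qed
  have "VPMt = relabel_along (P \<union> Pd \<union> Mu \<union> My) \<sigma> \<tau> (orth (P \<union> Pd \<union> Mu \<union> My) VPM)"
    unfolding VPMt by (rule relabel_eq_relabel_along) (auto simp: on \<sigma>)
  moreover have "VWMt = relabel_along (W \<union> Wd \<union> Mu \<union> My) \<sigma> \<tau> (orth (W \<union> Wd \<union> Mu \<union> My) VWM)"
    unfolding VWMt by (rule relabel_eq_relabel_along) (auto simp: on \<sigma>)
  moreover have "VPt = relabel_along (P \<union> Pd) \<sigma> \<tau> (orth (P \<union> Pd) VP)"
    unfolding VPt by (rule relabel_eq_relabel_along) (auto simp: on \<sigma>)
  moreover have "VWt = relabel_along (W \<union> Wd) \<sigma> \<tau> (orth (W \<union> Wd) VW)"
    unfolding VWt by (rule relabel_eq_relabel_along) (auto simp: on \<sigma>)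
  moreover have "\<tau> ` (Mu \<union> My) = Mu' \<union> My'" by (auto simp: image_Un im)
  ultimately show ?thesis
    using core[of "Mu \<union> My" VWM] core[of "{}" VW] VWM VW by (simp flip: Un_assoc)
qed

end
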